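(* Let $X_1,\dots,X_n$ be independent $\mathcal{X}$-valued random variables, let $k:\mathcal{X}\times\mathcal{X}\to\mathbb{R}$ be a positive semidefinite kernel with separable reproducing kernel Hilbert space $\mathcal{H}$, and assume that there is $M\in(0,+\infty)$ such that $k(X_i,X_i)\le M^2$ almost surely for every $i\in\{1,\dots,n\}$. Let $\tau\in\mathcal{T}_n$ be a segmentation with $D_\tau$ segments, let $\Pi_\tau$ be the orthogonal projection of $\mathcal{H}^n$ onto $F_\tau$, and let $\varepsilon=(\varepsilon_1,\dots,\varepsilon_n)\in\mathcal{H}^n$ be the noise vector (all defined in the context). Then for every $x>0$, with probability at least $1-e^{-x}$, $$\|\Pi_\tau\varepsilon\|^2-\mathbb{E}\left[\|\Pi_\tau\varepsilon\|^2\right]\le \frac{14M^2}{3}\left(x+2\sqrt{2xD_\tau}\right).$$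
   Context: $\mathcal{X}$ is a measurable set and $n\ge 1$ an integer. A positive semidefinite kernel is a measurable function $k:\mathcal{X}\times\mathcal{X}\to\mathbb{R}$ such that for any $x_1,\dots,x_n\in\mathcal{X}$ the matrix $(k(x_i,x_j))_{1\le i,j\le n}$ is (symmetric) positive semidefinite. $\mathcal{H}$ is the reproducing kernel Hilbert space of $k$, assumed separable throughout, with inner product $\langle\cdot,\cdot\rangle_{\mathcal{H}}$ and norm $\|\cdot\|_{\mathcal{H}}$; $\Phi:\mathcal{X}\to\mathcal{H}$, $\Phi(x)=k(x,\cdot)$ is the canonical feature map. Set $Y_i=\Phi(X_i)\in\mathcal{H}$, so that $\|Y_i\|_{\mathcal{H}}^2=k(X_i,X_i)$. Let $\mu^\star_i\in\mathcal{H}$ be the (Bochner) mean of $Y_i$, characterized by $\langle\mu^\star_i,g\rangle_{\mathcal{H}}=\mathbb{E}[\langle Y_i,g\rangle_{\mathcal{H}}]$ for all $g\in\mathcal{H}$ (it exists under the boundedness assumption), and $\varepsilon_i=Y_i-\mu^\star_i$. For $D\in\{1,\dots,n\}$, $\mathcal{T}_n^D$ is the set of integer sequences $\tau=(\tau_0,\dots,\tau_D)$ with $0=\tau_0<\tau_1<\dots<\tau_D=n$; such a $\tau$ is a segmentation with $D_\tau:=D$ segments; $\mathcal{T}_n=\bigcup_{D=1}^n\mathcal{T}_n^D$. For $\tau\in\mathcal{T}_n$, $$F_\tau=\{f=(f_1,\dots,f_n)\in\mathcal{H}^n:\ f_{\tau_{\ell-1}+1}=\dots=f_{\tau_\ell}\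 \text{ for all } 1\le\ell\le D_\tau\}.$$ $\mathcal{H}^n$ carries the inner product $\langle f,g\rangle=\sum_{i=1}^n\langle f_i,g_i\rangle_{\mathcal{H}}$ with norm $\|\cdot\|$, and $\Pi_\tau$ is the orthogonal projection onto the linear subspace $F_\tau$. *)

theory Defs
  imports "HOL-Probability.Probability"
begin

text \<open>
  The measurable set on which kernels live is the \<open>space\<close> of a measure \<open>N\<close>, of which only the
  \<open>\<sigma>\<close>-algebra is used.
\<close>

definition psd_kernel :: "'x measure \<Rightarrow> ('x \<Rightarrow> 'x \<Rightarrow> real) \<Rightarrow> bool" where
  "psd_kernel N k \<longleftrightarrow>
     (\<lambda>(x, y). k x y) \<in> borel_measurable (N \<Otimes>\<^sub>M N) \<and>
     (\<forall>(m::nat) x. (\<forall>i\<in>{1..m}. x i \<in> space N) \<longrightarrow>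
        (\<forall>i\<in>{1..m}. \<forall>j\<in>{1..m}. k (x i) (x j) = k (x j) (x i)) \<and>
        (\<forall>c::nat \<Rightarrow> real. 0 \<le> (\<Sum>i=1..m. \<Sum>j=1..m. c i * c j * k (x i) (x j))))"

text \<open>
  A reproducing kernel Hilbert space is a Hilbert space of real functions on \<open>S\<close>. So that the
  Bochner integral of the library applies, its elements are the elements of a Hilbert space type
  \<open>'h\<close>, and \<open>fct f\<close> is the function on \<open>S\<close> that \<open>f\<close> stands for (its values outside \<open>S\<close> are
  irrelevant). The first three conditions say that \<open>'h\<close> is, via \<open>fct\<close>, a vector space of functions
  on \<open>S\<close> with pointwise operations; the last one says that every \<open>k x\<close> belongs to this space and
  has the reproducing property. These conditions determine the function space and its inner product
  uniquely from \<open>k\<close>. Separability is the class \<open>second_countable_topology\<close>.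
\<close>

definition is_rkhs ::
  "'x set \<Rightarrow> ('x \<Rightarrow> 'x \<Rightarrow> real) \<Rightarrow>
   ('h :: {real_inner, banach, second_countable_topology} \<Rightarrow> 'x \<Rightarrow> real) \<Rightarrow> bool" where
  "is_rkhs S k fct \<longleftrightarrow>
     (\<forall>f g. \<forall>x\<in>S. fct (f + g) x = fct f x + fct g x) \<and>
     (\<forall>c f. \<forall>x\<in>S. fct (c *\<^sub>R f) x = c * fct f x) \<and>
     (\<forall>f g. (\<forall>x\<in>S. fct f x = fct g x) \<longrightarrow> f = g) \<and>
     (\<forall>x\<in>S. \<exists>h. (\<forall>y\<in>S. fct h y = k x y) \<and> (\<forall>f. f \<bullet> h = fct f x))"

definition feature_map ::
  "'x set \<Rightarrow> ('x \<Rightarrow> 'x \<Rightarrow> real) \<Rightarrow>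
   ('h :: {real_inner, banach, second_countable_topology} \<Rightarrow> 'x \<Rightarrow> real) \<Rightarrow> 'x \<Rightarrow> 'h" where
  "feature_map S k fct x = (THE h. \<forall>y\<in>S. fct h y = k x y)"

text \<open>Elements of \<open>'h\<^sup>n\<close> are the functions in \<open>{1..n} \<rightarrow>\<^sub>E UNIV\<close>.\<close>

definition tuple_inner :: "nat \<Rightarrow> (nat \<Rightarrow> 'h :: real_inner) \<Rightarrow> (nat \<Rightarrow> 'h) \<Rightarrow> real" where
  "tuple_inner n f g = (\<Sum>i=1..n. f i \<bullet> g i)"

definition tuple_norm :: "nat \<Rightarrow> (nat \<Rightarrow> 'h :: real_inner) \<Rightarrow> real" where
  "tuple_norm n f = sqrt (tuple_inner n f f)"

definition segmentations_of_size :: "nat \<Rightarrow> nat \<Rightarrow> nat list set" where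
  "segmentations_of_size n D =
     {\<tau>. length \<tau> = D + 1 \<and> \<tau> ! 0 = 0 \<and> \<tau> ! D = n \<and> (\<forall>l<D. \<tau> ! l < \<tau> ! (l + 1))}"

definition segmentations :: "nat \<Rightarrow> nat list set" where
  "segmentations n = (\<Union>D\<in>{1..n}. segmentations_of_size n D)"

definition num_segments :: "nat list \<Rightarrow> nat" where
  "num_segments \<tau> = length \<tau> - 1"

definition segment_space :: "nat \<Rightarrow> nat list \<Rightarrow> (nat \<Rightarrow> 'h :: real_inner) set" where
  "segment_space n \<tau> =
     {f \<in> {1..n} \<rightarrow>\<^sub>E UNIV.
        \<forall>l\<in>{1..num_segments \<tau>}.
          \<forall>i\<in>{\<tau> ! (l - 1) + 1..\<tau> ! l}. \<forall>j\<in>{\<tau> ! (l - 1) + 1..\<tau> ! l}. f i = f j}"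

text \<open>
  The projection is unique as a function on all of \<open>nat\<close> because the elements of the subspaces
  \<open>F \<subseteq> {1..n} \<rightarrow>\<^sub>E UNIV\<close> are extensional.
\<close>

definition orth_proj ::
  "nat \<Rightarrow> (nat \<Rightarrow> 'h :: real_inner) set \<Rightarrow> (nat \<Rightarrow> 'h) \<Rightarrow> (nat \<Rightarrow> 'h)" where
  "orth_proj n F f = (THE p. p \<in> F \<and> (\<forall>g\<in>F. tuple_inner n (\<lambda>i. f i - p i) g = 0))"

definition noise ::
  "'w measure \<Rightarrow> 'x measure \<Rightarrow> ('x \<Rightarrow> 'x \<Rightarrow> real) \<Rightarrow>
   ('h :: {real_inner, banach, second_countable_topology} \<Rightarrow> 'x \<Rightarrow> real) \<Rightarrow>
   nat \<Rightarrow> (nat \<Rightarrow> 'w \<Rightarrow> 'x) \<Rightarrow> 'w \<Rightarrow> nat \<Rightarrow> 'h" where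
  "noise P N k fct n X \<omega> =
     (\<lambda>i\<in>{1..n}. feature_map (space N) k fct (X i \<omega>)
        - (\<integral>\<omega>'. feature_map (space N) k fct (X i \<omega>') \<partial>P))"

end

theory Submission
  imports Defs
begin

text \<open>
  The projection onto \<open>F\<^sub>\<tau>\<close> averages over each segment, so \<open>\<parallel>\<Pi>\<^sub>\<tau> \<epsilon>\<parallel>\<^sup>2\<close> is the sum over the
  segments \<open>l\<close> of \<open>W\<^sub>l = \<parallel>S\<^sub>l\<parallel>\<^sup>2 / m\<^sub>l\<close>, where \<open>S\<^sub>l\<close> is the sum of the noise over the segment and
  \<open>m\<^sub>l\<close> is its length (\<open>norm_orth_proj_segment_space\<close>). The \<open>W\<^sub>l\<close> are independent. If each of
  them satisfies \<open>E exp (u (W\<^sub>l - E W\<^sub>l) / c) \<le> exp (2 u\<^sup>2)\<close> for all \<open>u \<in> [0,1]\<close>, with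
  \<open>c = 14 M\<^sup>2 / 3\<close>, then Markov's inequality for the exponential, with \<open>u = min 1 (sqrt (x / (2 D)))\<close>,
  is the claim (\<open>prob_sum_le_of_exp_moments\<close>).

  The bound on \<open>W\<^sub>l\<close> comes from an exponential moment of the squared norm of a sum of \<open>m\<close>
  independent centred vectors. Adding a vector \<open>e = Y - E Y\<close> with \<open>\<parallel>Y\<parallel> \<le> M\<close> to a fixed \<open>s\<close> gives
  \<open>\<parallel>s + e\<parallel>\<^sup>2 \<le> \<parallel>s\<parallel>\<^sup>2 + 2 \<langle>s, e\<rangle> + 4 M\<^sup>2\<close>, where \<open>\<langle>s, e\<rangle>\<close> is a centred real variable with values in
  an interval of length \<open>2 M \<parallel>s\<parallel>\<close>. Hoeffding's lemma therefore bounds \<open>E exp (\<lambda> \<parallel>s + e\<parallel>\<^sup>2)\<close> by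
  \<open>exp (4 \<lambda> M\<^sup>2 + (\<lambda> + 2 \<lambda>\<^sup>2 M\<^sup>2) \<parallel>s\<parallel>\<^sup>2)\<close>. The values \<open>\<lambda>\<^sub>j = 1 / (M\<^sup>2 (L + 2 j))\<close> satisfy
  \<open>\<lambda>\<^sub>j + 2 \<lambda>\<^sub>j\<^sup>2 M\<^sup>2 \<le> \<lambda>\<^sub>j\<^sub>-\<^sub>1\<close>, and the factors \<open>exp (4 \<lambda>\<^sub>j M\<^sup>2)\<close> are dominated by telescoping
  quotients, which yields \<open>E exp (\<parallel>S\<^sub>m\<parallel>\<^sup>2 / (M\<^sup>2 (L + 2 m))) \<le> ((L + 2 m) / L)\<^sup>2\<close> by induction
  (\<open>nn_integral_exp_norm_sum_centered\<close>). With \<open>L = 2 m\<close> this reads \<open>E exp (W / (4 M\<^sup>2)) \<le> 4\<close>.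
  For \<open>T = W / c\<close> and \<open>\<phi> t = exp t - 1 - t\<close> the elementary inequalities \<open>\<phi> (u T) \<le> u\<^sup>2 \<phi> T\<close> and
  \<open>\<phi> T \<le> 2 / 3 (exp (7 T / 6) - 1) = 2 / 3 (exp (W / (4 M\<^sup>2)) - 1)\<close> turn this into
  \<open>E exp (u T) \<le> 1 + u E T + 2 u\<^sup>2\<close>, and hence into the bound wanted.
\<close>

section \<open>The second-order remainder of the exponential function\<close>

lemma exp_remainder_scale:
  fixes t u :: real
  assumes "0 \<le> t" "0 \<le> u" "u \<le> 1"
  shows "exp (u * t) - 1 - u * t \<le> u\<^sup>2 * (exp t - 1 - t)"
proof -
  define f where "f = (\<lambda>s::real. u\<^sup>2 * (exp s - 1 - s) - (exp (u * s) - 1 - u * s))"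
  have "f 0 \<le> f t"
  proof (rule DERIV_nonneg_imp_nondecreasing[OF \<open>0 \<le> t\<close>])
    fix s :: real assume "0 \<le> s" "s \<le> t"
    have "exp (u * s) \<le> (1 - u) * exp 0 + u * exp s"
      using convex_onD[OF exp_convex, of u 0 s] assms by simp
    then have "0 \<le> u * (u * (exp s - 1) - (exp (u * s) - 1))"
      using assms by (intro mult_nonneg_nonneg) (auto simp: algebra_simps)
    moreover have "(f has_real_derivative u * (u * (exp s - 1) - (exp (u * s) - 1))) (at s)"
      unfolding f_def
      by (auto intro!: derivative_eq_intros simp: algebra_simps power2_eq_square)
    ultimately show "\<exists>y. (f has_real_derivative y) (at s) \<and> 0 \<le> y"
      by blast
  qed
  then show ?thesis by (simp add: f_def)
qed

lemma exp_remainder_le: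
  fixes t :: real
  assumes "0 \<le> t"
  shows "exp t - 1 - t \<le> 2 / 3 * (exp (7 / 6 * t) - 1)"
proof -
  define f where "f = (\<lambda>s::real. 2 / 3 * (exp (7 / 6 * s) - 1) - (exp s - 1 - s))"
  have "f 0 \<le> f t"
  proof (rule DERIV_nonneg_imp_nondecreasing[OF assms])
    fix s :: real assume s: "0 \<le> s" "s \<le> t"
    define y where "y = exp (s / 6)"
    have y1: "1 \<le> y" using s by (simp add: y_def)
    have y6: "exp s = y ^ 6" and y7: "exp (7 / 6 * s) = y ^ 7"
      by (simp_all add: y_def flip: exp_of_nat_mult)
    \<comment> \<open>the derivative of \<open>f\<close> at \<open>s\<close> is \<open>7 / 9 * y ^ 7 - y ^ 6 + 1\<close>\<close>
    have "y ^ 6 * (9 - 7 * y) \<le> 9"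
    proof -
      consider "y \<le> 6 / 5" | "6 / 5 \<le> y" "y \<le> 9 / 7" | "9 / 7 \<le> y" by linarith
      then show ?thesis
      proof cases
        case 1
        then have "y ^ 6 * (9 - 7 * y) \<le> (6 / 5) ^ 6 * 2"
          using y1 by (intro mult_mono power_mono) auto
        then show ?thesis by (simp add: power_divide)
      next
        case 2
        then have "y ^ 6 * (9 - 7 * y) \<le> (9 / 7) ^ 6 * (3 / 5)"
          using y1 by (intro mult_mono power_mono) auto
        then show ?thesis by (simp add: power_divide)
      next
        case 3
        then have "y ^ 6 * (9 - 7 * y) \<le> 0"
          using y1 by (intro mult_nonneg_nonpos) auto
        then show ?thesis by simp
      qed
    qed
    then have "0 \<le> 7 / 9 * exp (7 / 6 * s) - (exp s - 1)"
      unfolding y6 y7 by (simp add: algebra_simps eval_nat_numeral)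
    moreover have "(f has_real_derivative 7 / 9 * exp (7 / 6 * s) - (exp s - 1)) (at s)"
      unfolding f_def by (auto intro!: derivative_eq_intros)
    ultimately show "\<exists>y. (f has_real_derivative y) (at s) \<and> 0 \<le> y"
      by blast
  qed
  then show ?thesis by (simp add: f_def)
qed

section \<open>Exponential moments of sums of bounded vectors\<close>

context prob_space
begin

lemma nn_integral_exp_norm_add_centered:
  fixes V :: "'a \<Rightarrow> 'h :: {real_inner, banach, second_countable_topology}"
  assumes [measurable]: "random_variable borel V"
    and bd: "AE \<omega> in M. norm (V \<omega>) \<le> B" and "0 < l"
  shows "(\<integral>\<^sup>+\<omega>. exp (l * (norm (s + (V \<omega> - expectation V)))\<^sup>2) \<partial>M)
    \<le> ennreal (exp (4 * l * B\<^sup>2) * exp ((l + 2 * l\<^sup>2 * B\<^sup>2) * (norm s)\<^sup>2))"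
proof -
  define m where "m = expectation V"
  have int: "integrable M V"
    using bd by (intro integrable_const_bound[where B = B]) auto
  have m: "norm m \<le> B"
  proof -
    have "norm m \<le> expectation (\<lambda>\<omega>. norm (V \<omega>))"
      unfolding m_def by (rule integral_norm_bound)
    also have "\<dots> \<le> expectation (\<lambda>_. B)"
      using bd int by (intro integral_mono_AE) auto
    finally show ?thesis by (simp add: prob_space)
  qed
  have Em: "expectation (\<lambda>\<omega>. s \<bullet> V \<omega>) = s \<bullet> m"
    unfolding m_def using int by simp
  interpret sV: interval_bounded_random_variable M "\<lambda>\<omega>. s \<bullet> V \<omega>" "- (norm s * B)" "norm s * B"
  proof
    show "AE \<omega> in M. s \<bullet> V \<omega> \<in> {- (norm s * B)..norm s * B}"
      using bd
    proof eventually_elim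
      case (elim \<omega>)
      have "\<bar>s \<bullet> V \<omega>\<bar> \<le> norm s * norm (V \<omega>)" by (rule Cauchy_Schwarz_ineq2)
      also have "\<dots> \<le> norm s * B" using elim by (intro mult_left_mono) auto
      finally show ?case by (auto simp: abs_le_iff)
    qed
  qed simp
  have "(\<integral>\<^sup>+\<omega>. exp (l * (norm (s + (V \<omega> - m)))\<^sup>2) \<partial>M)
      \<le> (\<integral>\<^sup>+\<omega>. ennreal (exp (4 * l * B\<^sup>2) * exp (l * (norm s)\<^sup>2)) * exp (2 * l * (s \<bullet> V \<omega> - s \<bullet> m)) \<partial>M)"
  proof (rule nn_integral_mono_AE)
    show "AE \<omega> in M. ennreal (exp (l * (norm (s + (V \<omega> - m)))\<^sup>2))
        \<le> ennreal (exp (4 * l * B\<^sup>2) * exp (l * (norm s)\<^sup>2)) * exp (2 * l * (s \<bullet> V \<omega> - s \<bullet> m))"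
      using bd
    proof eventually_elim
      case (elim \<omega>)
      have "norm (V \<omega> - m) \<le> 2 * B"
        using norm_triangle_ineq4[of "V \<omega>" m] elim m by linarith
      then have "(norm (V \<omega> - m))\<^sup>2 \<le> (2 * B)\<^sup>2" by (rule power_mono) simp
      then have "(norm (s + (V \<omega> - m)))\<^sup>2 \<le> 4 * B\<^sup>2 + (norm s)\<^sup>2 + 2 * (s \<bullet> V \<omega> - s \<bullet> m)"
        by (simp add: power2_norm_eq_inner inner_simps inner_commute power_mult_distrib)
      then have "l * (norm (s + (V \<omega> - m)))\<^sup>2 \<le> l * (4 * B\<^sup>2 + (norm s)\<^sup>2 + 2 * (s \<bullet> V \<omega> - s \<bullet> m))"
        using \<open>0 < l\<close> by (intro mult_left_mono) auto
      then have "exp (l * (norm (s + (V \<omega> - m)))\<^sup>2)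
          \<le> exp (4 * l * B\<^sup>2 + l * (norm s)\<^sup>2 + 2 * l * (s \<bullet> V \<omega> - s \<bullet> m))"
        by (simp add: algebra_simps)
      then show ?case
        by (simp add: exp_add flip: ennreal_mult)
    qed
  qed
  also have "\<dots> = ennreal (exp (4 * l * B\<^sup>2) * exp (l * (norm s)\<^sup>2))
      * (\<integral>\<^sup>+\<omega>. exp (2 * l * (s \<bullet> V \<omega> - s \<bullet> m)) \<partial>M)"
    by (rule nn_integral_cmult) simp
  also have "\<dots> \<le> ennreal (exp (4 * l * B\<^sup>2) * exp (l * (norm s)\<^sup>2))
      * ennreal (exp ((2 * l)\<^sup>2 * (norm s * B - - (norm s * B))\<^sup>2 / 8))"
    using sV.Hoeffdings_lemma_nn_integral[of "2 * l"] \<open>0 < l\<close>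
    by (intro mult_left_mono) (auto simp: Em)
  also have "\<dots> = ennreal (exp (4 * l * B\<^sup>2) * exp ((l + 2 * l\<^sup>2 * B\<^sup>2) * (norm s)\<^sup>2))"
    by (simp add: algebra_simps power2_eq_square flip: ennreal_mult exp_add)
  finally show ?thesis unfolding m_def .
qed

text \<open>
  The coefficient of the squared norm decreases with the number of summands: the increase that
  Hoeffding's lemma causes when one summand is integrated out leads at most to the coefficient for
  the remaining summands. The parameter \<open>L > 0\<close> keeps the coefficient finite when no summand is left.
\<close>

lemma nn_integral_exp_norm_sum_centered:
  fixes V :: "'i \<Rightarrow> 'a \<Rightarrow> 'h :: {real_inner, banach, second_countable_topology}" and B L :: real
  assumes "finite I" and indep: "indep_vars (\<lambda>_. borel) V I"
    and bd: "\<And>i. i \<in> I \<Longrightarrow> AE \<omega> in M. norm (V i \<omega>) \<le> B" and "0 < B" "0 < L"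
  shows "(\<integral>\<^sup>+\<omega>. exp ((norm (\<Sum>i\<in>I. V i \<omega> - expectation (V i)))\<^sup>2 / (B\<^sup>2 * (L + 2 * card I))) \<partial>M)
    \<le> ennreal (((L + 2 * card I) / L)\<^sup>2)"
  using assms(1) indep bd
proof (induction I rule: finite_induct)
  case empty
  then show ?case using \<open>0 < L\<close> by (simp add: emeasure_space_1)
next
  case (insert j I)
  define a where "a = L + 2 * card I"
  define l where "l = 1 / (B\<^sup>2 * (a + 2))"
  have a: "0 < a" using \<open>0 < L\<close> by (simp add: a_def)
  have l: "0 < l" using a \<open>0 < B\<close> by (simp add: l_def)
  define S where "S = (\<lambda>v. \<Sum>i\<in>I. v i - expectation (V i))"
  have rv[measurable]: "random_variable borel (V i)" if "i \<in> insert j I" for i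
    using insert.prems(1) that by (auto simp: indep_vars_def)
  have Vj[measurable]: "random_variable borel (V j)" by (rule rv) simp
  have S[measurable]: "S \<in> borel_measurable (PiM I (\<lambda>_. borel))"
    unfolding S_def by measurable
  define R where "R = (\<lambda>\<omega>. S (restrict (\<lambda>i. V i \<omega>) I))"
  have R_eq: "R \<omega> = (\<Sum>i\<in>I. V i \<omega> - expectation (V i))" for \<omega>
    by (simp add: R_def S_def)
  have R[measurable]: "random_variable borel R"
    unfolding R_eq[abs_def] using rv by measurable
  have "indep_var borel (S \<circ> (\<lambda>\<omega>. restrict (\<lambda>i. V i \<omega>) I)) borel
      ((\<lambda>v. v j) \<circ> (\<lambda>\<omega>. restrict (\<lambda>i. V i \<omega>) {j}))"
    using insert.hyps
    by (intro indep_var_compose[OF indep_var_restrict[OF insert.prems(1)]]) auto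
  then have ind: "indep_var borel R borel (V j)"
    by (simp add: R_def[abs_def] comp_def)
  have D: "distr M borel R \<Otimes>\<^sub>M distr M borel (V j) = distr M (borel \<Otimes>\<^sub>M borel) (\<lambda>\<omega>. (R \<omega>, V j \<omega>))"
    using ind by (simp add: indep_var_distribution_eq)
  interpret Dj: prob_space "distr M borel (V j)" by (rule prob_space_distr) simp
  let ?f = "\<lambda>(r, v). ennreal (exp (l * (norm (r + (v - expectation (V j))))\<^sup>2))"
  have "(\<integral>\<^sup>+\<omega>. exp ((norm (\<Sum>i\<in>insert j I. V i \<omega> - expectation (V i)))\<^sup>2
          / (B\<^sup>2 * (L + 2 * card (insert j I)))) \<partial>M)
      = (\<integral>\<^sup>+\<omega>. ?f (R \<omega>, V j \<omega>) \<partial>M)"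
    using insert.hyps by (simp add: R_eq l_def a_def algebra_simps)
  also have "\<dots> = (\<integral>\<^sup>+p. ?f p \<partial>(distr M borel R \<Otimes>\<^sub>M distr M borel (V j)))"
    unfolding D by (subst nn_integral_distr) simp_all
  also have "\<dots> = (\<integral>\<^sup>+r. \<integral>\<^sup>+v. ?f (r, v) \<partial>distr M borel (V j) \<partial>distr M borel R)"
    by (rule Dj.nn_integral_fst[symmetric]) simp
  also have "\<dots> = (\<integral>\<^sup>+\<omega>. \<integral>\<^sup>+\<omega>'. ?f (R \<omega>, V j \<omega>') \<partial>M \<partial>M)"
    by (simp add: nn_integral_distr)
  also have "\<dots> \<le> (\<integral>\<^sup>+\<omega>. ennreal (((a + 2) / a)\<^sup>2) * exp ((norm (R \<omega>))\<^sup>2 / (B\<^sup>2 * a)) \<partial>M)"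
  proof (rule nn_integral_mono)
    fix \<omega>
    \<comment> \<open>one step of the recursion for \<open>l\<close>, and \<open>exp y \<le> 1 / (1 - y)\<close> at \<open>y = 2 / (a + 2)\<close>\<close>
    have 1: "l + 2 * l\<^sup>2 * B\<^sup>2 \<le> 1 / (B\<^sup>2 * a)"
    proof -
      have l_eq: "l = (1 / (a + 2)) / B\<^sup>2" and lB: "l * B\<^sup>2 = 1 / (a + 2)"
        using a \<open>0 < B\<close> by (simp_all add: l_def)
      have "l + 2 * l\<^sup>2 * B\<^sup>2 = l * (1 + 2 * (l * B\<^sup>2))"
        by (simp add: algebra_simps power2_eq_square)
      also have "\<dots> = (1 / (a + 2) * (1 + 2 / (a + 2))) / B\<^sup>2"
        unfolding lB by (simp add: l_eq)
      also have "\<dots> \<le> (1 / a) / B\<^sup>2"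
      proof (rule divide_right_mono)
        have "1 + 2 / (a + 2) \<le> (a + 2) / a"
          using a by (simp add: field_simps)
        then have "1 / (a + 2) * (1 + 2 / (a + 2)) \<le> 1 / (a + 2) * ((a + 2) / a)"
          using a by (intro mult_left_mono) auto
        also have "\<dots> = 1 / a" using a by simp
        finally show "1 / (a + 2) * (1 + 2 / (a + 2)) \<le> 1 / a" .
      qed simp
      finally show ?thesis by (simp add: mult.commute)
    qed
    have 2: "exp (4 * l * B\<^sup>2) \<le> ((a + 2) / a)\<^sup>2"
    proof -
      have "1 - 2 / (a + 2) \<le> exp (- (2 / (a + 2)))"
        using exp_ge_add_one_self[of "- (2 / (a + 2))"] by simp
      then have "a / (a + 2) \<le> exp (- (2 / (a + 2)))"
        using a by (simp add: field_simps)
      then have "exp (2 / (a + 2)) \<le> (a + 2) / a"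
        using a by (simp add: exp_minus field_simps)
      then have "(exp (2 / (a + 2)))\<^sup>2 \<le> ((a + 2) / a)\<^sup>2"
        by (rule power_mono) simp
      moreover have "4 * l * B\<^sup>2 = 2 * (2 / (a + 2))"
        using a \<open>0 < B\<close> by (simp add: l_def)
      ultimately show ?thesis by (simp only: exp_double)
    qed
    have "(\<integral>\<^sup>+\<omega>'. ?f (R \<omega>, V j \<omega>') \<partial>M)
        \<le> ennreal (exp (4 * l * B\<^sup>2) * exp ((l + 2 * l\<^sup>2 * B\<^sup>2) * (norm (R \<omega>))\<^sup>2))"
      using nn_integral_exp_norm_add_centered[OF Vj insert.prems(2)[of j] l, of "R \<omega>"] by simp
    also have "\<dots> \<le> ennreal (((a + 2) / a)\<^sup>2 * exp ((norm (R \<omega>))\<^sup>2 / (B\<^sup>2 * a)))"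
      using mult_right_mono[OF 1, of "(norm (R \<omega>))\<^sup>2"]
      by (intro ennreal_leI mult_mono 2) auto
    finally show "(\<integral>\<^sup>+\<omega>'. ?f (R \<omega>, V j \<omega>') \<partial>M)
        \<le> ennreal (((a + 2) / a)\<^sup>2) * exp ((norm (R \<omega>))\<^sup>2 / (B\<^sup>2 * a))"
      by (simp add: ennreal_mult)
  qed
  also have "\<dots> = ennreal (((a + 2) / a)\<^sup>2) * (\<integral>\<^sup>+\<omega>. exp ((norm (R \<omega>))\<^sup>2 / (B\<^sup>2 * a)) \<partial>M)"
    by (rule nn_integral_cmult) simp
  also have "\<dots> \<le> ennreal (((a + 2) / a)\<^sup>2) * ennreal ((a / L)\<^sup>2)"
    using insert.IH[OF indep_vars_subset[OF insert.prems(1)]] insert.prems(2)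
    by (intro mult_left_mono) (auto simp: R_eq a_def)
  also have "\<dots> = ennreal (((L + 2 * card (insert j I)) / L)\<^sup>2)"
    using insert.hyps a by (simp add: a_def field_simps flip: ennreal_mult)
  finally show ?case .
qed

text \<open>
  Only the range \<open>u \<le> 1\<close> is covered, since the remainder of \<open>exp\<close> at \<open>u * T\<close> is compared with that
  at \<open>T\<close>.
\<close>

lemma
  fixes V :: "'i \<Rightarrow> 'a \<Rightarrow> 'h :: {real_inner, banach, second_countable_topology}" and B :: real
  assumes fin: "finite I" and ne: "I \<noteq> {}" and indep: "indep_vars (\<lambda>_. borel) V I"
    and bd: "\<And>i. i \<in> I \<Longrightarrow> AE \<omega> in M. norm (V i \<omega>) \<le> B" and B: "0 < B"
  defines "W \<equiv> \<lambda>\<omega>. (norm (\<Sum>i\<in>I. V i \<omega> - expectation (V i)))\<^sup>2 / card I"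
  shows integrable_norm_sum_centered: "integrable M W"
    and nn_integral_exp_centered_norm_sum: "\<And>u. 0 \<le> u \<Longrightarrow> u \<le> 1 \<Longrightarrow>
      (\<integral>\<^sup>+\<omega>. exp (u * ((W \<omega> - expectation W) / (14 * B\<^sup>2 / 3))) \<partial>M) \<le> ennreal (exp (2 * u\<^sup>2))"
proof -
  have c: "0 < real (card I)" using fin ne by (simp add: card_gt_0_iff)
  have rv[measurable]: "random_variable borel (V i)" if "i \<in> I" for i
    using indep that by (auto simp: indep_vars_def)
  have W[measurable]: "random_variable borel W"
    unfolding W_def by measurable
  have W0: "0 \<le> W \<omega>" for \<omega> by (simp add: W_def)
  \<comment> \<open>the choice \<open>L = 2 * card I\<close>\<close>
  have "(\<integral>\<^sup>+\<omega>. exp (W \<omega> / (4 * B\<^sup>2)) \<partial>M) \<le> ennreal (((2 * card I + 2 * card I) / (2 * card I))\<^sup>2)"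
    using nn_integral_exp_norm_sum_centered[OF fin indep bd B, of "2 * card I"] c
    by (simp add: W_def mult_ac)
  also have "((2 * card I + 2 * card I) / (2 * card I))\<^sup>2 = (4 :: real)"
    using c by simp
  finally have E4: "(\<integral>\<^sup>+\<omega>. exp (W \<omega> / (4 * B\<^sup>2)) \<partial>M) \<le> ennreal 4"
    by simp
  have int_exp: "integrable M (\<lambda>\<omega>. exp (W \<omega> / (4 * B\<^sup>2)))"
    using E4 by (intro integrableI_nonneg) (auto intro: le_less_trans)
  have E4': "expectation (\<lambda>\<omega>. exp (W \<omega> / (4 * B\<^sup>2))) \<le> 4"
    using E4 unfolding nn_integral_eq_integral[OF int_exp, simplified]
    by (subst (asm) ennreal_le_iff) auto
  show int: "integrable M W"
  proof (rule Bochner_Integration.integrable_bound)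
    show "integrable M (\<lambda>\<omega>. 4 * B\<^sup>2 * exp (W \<omega> / (4 * B\<^sup>2)))"
      using int_exp by simp
    have "W \<omega> \<le> 4 * B\<^sup>2 * exp (W \<omega> / (4 * B\<^sup>2))" for \<omega>
    proof -
      have "4 * B\<^sup>2 * (W \<omega> / (4 * B\<^sup>2)) \<le> 4 * B\<^sup>2 * exp (W \<omega> / (4 * B\<^sup>2))"
        by (intro mult_left_mono less_imp_le[OF exp_gt_self]) auto
      then show ?thesis using B by simp
    qed
    then show "AE \<omega> in M. norm (W \<omega>) \<le> norm (4 * B\<^sup>2 * exp (W \<omega> / (4 * B\<^sup>2)))"
      using W0 by (intro AE_I2) (simp add: abs_mult)
  qed simp
  fix u :: real assume u: "0 \<le> u" "u \<le> 1"
  define T where "T = (\<lambda>\<omega>. W \<omega> / (14 * B\<^sup>2 / 3))"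
  have T0: "0 \<le> T \<omega>" for \<omega> using W0 by (simp add: T_def)
  have int_T: "integrable M T" unfolding T_def using int by simp
  have 7: "7 / 6 * T \<omega> = W \<omega> / (4 * B\<^sup>2)" for \<omega>
    by (simp add: T_def)
  have le: "exp (u * T \<omega>) \<le> 1 + u * T \<omega> + u\<^sup>2 * (2 / 3) * (exp (W \<omega> / (4 * B\<^sup>2)) - 1)" for \<omega>
    using exp_remainder_scale[OF T0 u, of \<omega>]
      mult_left_mono[OF exp_remainder_le[OF T0], of "u\<^sup>2" \<omega>]
    unfolding 7 by (simp add: algebra_simps)
  have int_uT: "integrable M (\<lambda>\<omega>. exp (u * T \<omega>))"
  proof (rule Bochner_Integration.integrable_bound)
    show "integrable M (\<lambda>\<omega>. 1 + u * T \<omega> + u\<^sup>2 * (2 / 3) * (exp (W \<omega> / (4 * B\<^sup>2)) - 1))"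
      using int_T int_exp by simp
    show "AE \<omega> in M. norm (exp (u * T \<omega>))
        \<le> norm (1 + u * T \<omega> + u\<^sup>2 * (2 / 3) * (exp (W \<omega> / (4 * B\<^sup>2)) - 1))"
      using order_trans[OF le abs_ge_self] by simp
  qed (simp add: T_def)
  have "expectation (\<lambda>\<omega>. exp (u * T \<omega>))
      \<le> expectation (\<lambda>\<omega>. 1 + u * T \<omega> + u\<^sup>2 * (2 / 3) * (exp (W \<omega> / (4 * B\<^sup>2)) - 1))"
    using int_T int_exp int_uT le by (intro integral_mono) auto
  also have "\<dots> = 1 + u * expectation T
      + u\<^sup>2 * (2 / 3) * (expectation (\<lambda>\<omega>. exp (W \<omega> / (4 * B\<^sup>2))) - 1)"
    using int_T int_exp by (simp add: prob_space)
  also have "\<dots> \<le> 1 + u * expectation T + u\<^sup>2 * (2 / 3) * 3"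
    using E4' by (intro add_left_mono mult_left_mono) auto
  also have "\<dots> \<le> exp (u * expectation T + 2 * u\<^sup>2)"
    using exp_ge_add_one_self[of "u * expectation T + 2 * u\<^sup>2"] by linarith
  finally have E: "expectation (\<lambda>\<omega>. exp (u * T \<omega>)) \<le> exp (u * expectation T + 2 * u\<^sup>2)" .
  have ET: "expectation T = expectation W / (14 * B\<^sup>2 / 3)"
    unfolding T_def by simp
  have "(\<integral>\<^sup>+\<omega>. exp (u * ((W \<omega> - expectation W) / (14 * B\<^sup>2 / 3))) \<partial>M)
      = (\<integral>\<^sup>+\<omega>. ennreal (exp (- (u * expectation T))) * exp (u * T \<omega>) \<partial>M)"
    by (simp add: ET T_def diff_divide_distrib right_diff_distrib flip: ennreal_mult exp_add)
  also have "\<dots> = ennreal (exp (- (u * expectation T))) * (\<integral>\<^sup>+\<omega>. exp (u * T \<omega>) \<partial>M)"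
    by (rule nn_integral_cmult) (simp add: T_def)
  also have "\<dots> = ennreal (exp (- (u * expectation T)) * expectation (\<lambda>\<omega>. exp (u * T \<omega>)))"
    by (subst nn_integral_eq_integral[OF int_uT]) (auto simp: ennreal_mult)
  also have "\<dots> \<le> ennreal (exp (- (u * expectation T)) * exp (u * expectation T + 2 * u\<^sup>2))"
    using E by (intro ennreal_leI mult_left_mono) auto
  also have "\<dots> = ennreal (exp (2 * u\<^sup>2))"
    by (simp flip: exp_add)
  finally show "(\<integral>\<^sup>+\<omega>. exp (u * ((W \<omega> - expectation W) / (14 * B\<^sup>2 / 3))) \<partial>M) \<le> ennreal (exp (2 * u\<^sup>2))" .
qed

section \<open>Concentration of a sum from exponential moments\<close>

lemma prob_sum_le_of_exp_moments:
  fixes W :: "'i \<Rightarrow> 'a \<Rightarrow> real" and c x :: real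
  assumes fin: "finite J" and ne: "J \<noteq> {}" and indep: "indep_vars (\<lambda>_. borel) W J"
    and mgf: "\<And>j u. j \<in> J \<Longrightarrow> 0 \<le> u \<Longrightarrow> u \<le> 1 \<Longrightarrow>
      (\<integral>\<^sup>+\<omega>. exp (u * ((W j \<omega> - m j) / c)) \<partial>M) \<le> ennreal (exp (2 * u\<^sup>2))"
    and c: "0 < c" and x: "0 < x"
  shows "1 - exp (- x)
    \<le> prob {\<omega> \<in> space M. (\<Sum>j\<in>J. W j \<omega>) - (\<Sum>j\<in>J. m j) \<le> c * (x + 2 * sqrt (2 * x * card J))}"
proof -
  define d where "d = real (card J)"
  define t where "t = x + 2 * sqrt (2 * x * d)"
  have d: "0 < d" using fin ne by (simp add: d_def card_gt_0_iff)
  have rv[measurable]: "random_variable borel (W j)" if "j \<in> J" for j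
    using indep that by (auto simp: indep_vars_def)
  \<comment> \<open>\<open>sqrt (x / (2 * d))\<close> balances \<open>u * sqrt (2 * x * d) = x\<close> and \<open>2 * u\<^sup>2 * d = x\<close>;
      where it exceeds \<open>1\<close>, \<open>u = 1\<close> suffices\<close>
  obtain u where u: "0 < u" "u \<le> 1" and opt: "x \<le> u * t - 2 * u\<^sup>2 * d"
  proof (cases "x \<le> 2 * d")
    case True
    define u where "u = sqrt (x / (2 * d))"
    have "u * sqrt (2 * x * d) = x"
      using x d by (simp add: u_def flip: real_sqrt_mult)
    moreover have "2 * u\<^sup>2 * d = x" using x d by (simp add: u_def)
    moreover have u: "0 < u" "u \<le> 1" using x d True by (auto simp: u_def)
    ultimately have "u * t - 2 * u\<^sup>2 * d = u * x + x"
      by (simp add: t_def algebra_simps)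
    then show ?thesis using that[of u] u x by simp
  next
    case False
    have "(2 * d)\<^sup>2 \<le> 2 * x * d" using False d by (simp add: power2_eq_square)
    then have "2 * d \<le> sqrt (2 * x * d)" by (rule real_le_rsqrt)
    moreover have "0 \<le> sqrt (2 * x * d)" using x d by simp
    ultimately have "x \<le> 1 * t - 2 * 1\<^sup>2 * d" using d unfolding t_def by simp
    then show ?thesis using that[of 1] by simp
  qed
  define Z where "Z = (\<lambda>\<omega>. \<Sum>j\<in>J. (W j \<omega> - m j) / c)"
  have Z[measurable]: "random_variable borel Z" unfolding Z_def by measurable
  have "emeasure M {\<omega> \<in> space M. Z \<omega> \<ge> t} \<le> ennreal (exp (- u * t)) * (\<integral>\<^sup>+\<omega>\<in>space M. exp (u * Z \<omega>) \<partial>M)"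
    using u by (intro Chernoff_ineq_nn_integral_ge) auto
  also have "(\<integral>\<^sup>+\<omega>\<in>space M. exp (u * Z \<omega>) \<partial>M)
      = (\<integral>\<^sup>+\<omega>. (\<Prod>j\<in>J. ennreal (exp (u * ((W j \<omega> - m j) / c)))) \<partial>M)"
    by (intro nn_integral_cong) (simp add: Z_def sum_distrib_left exp_sum fin prod_ennreal)
  also have "\<dots> = (\<Prod>j\<in>J. \<integral>\<^sup>+\<omega>. exp (u * ((W j \<omega> - m j) / c)) \<partial>M)"
    by (intro indep_vars_nn_integral fin indep_vars_compose2[OF indep]) auto
  also have "\<dots> \<le> (\<Prod>j\<in>J. ennreal (exp (2 * u\<^sup>2)))"
    using mgf u by (intro prod_mono_ennreal) auto
  also have "\<dots> = ennreal (exp (2 * u\<^sup>2 * d))"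
    by (simp add: d_def ennreal_power mult.commute flip: exp_of_nat_mult)
  also have "ennreal (exp (- u * t)) * \<dots> = ennreal (exp (- (u * t - 2 * u\<^sup>2 * d)))"
    by (simp flip: ennreal_mult exp_add)
  also have "\<dots> \<le> ennreal (exp (- x))" using opt by (intro ennreal_leI) simp
  finally have tail: "prob {\<omega> \<in> space M. Z \<omega> \<ge> t} \<le> exp (- x)"
    by (simp add: emeasure_eq_measure mult_left_mono)
  have sumZ: "(\<Sum>j\<in>J. W j \<omega>) - (\<Sum>j\<in>J. m j) = c * Z \<omega>" for \<omega>
    using c by (simp add: Z_def sum_subtractf flip: sum_divide_distrib)
  have "1 - exp (- x) \<le> 1 - prob {\<omega> \<in> space M. Z \<omega> \<ge> t}" using tail by simp
  also have "\<dots> = prob (space M - {\<omega> \<in> space M. Z \<omega> \<ge> t})"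
    by (rule prob_compl[symmetric]) simp
  also have "\<dots> \<le> prob {\<omega> \<in> space M. c * Z \<omega> \<le> c * t}"
    using c by (intro finite_measure_mono) auto
  finally show ?thesis by (simp add: sumZ t_def d_def)
qed

end

section \<open>Segmentations and the projection onto piecewise constant tuples\<close>

lemma segmentation_strict_mono:
  assumes "\<tau> \<in> segmentations_of_size n D" "i < j" "j \<le> D"
  shows "\<tau> ! i < \<tau> ! j"
  using assms(2,3)
proof (induction rule: strict_inc_induct)
  case (base i)
  then show ?case using assms(1) by (auto simp: segmentations_of_size_def)
next
  case (step i)
  then have "\<tau> ! i < \<tau> ! Suc i" using assms(1) by (auto simp: segmentations_of_size_def)
  with step show ?case by simp
qed

text \<open>
  The \<open>l\<close>-th segment of \<open>\<tau>\<close>; segments are numbered from \<open>1\<close>, and \<open>\<tau> ! 0 = 0\<close> in a segmentation.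
\<close>

definition segment :: "nat list \<Rightarrow> nat \<Rightarrow> nat set" where
  "segment \<tau> l = {\<tau> ! (l - 1) + 1..\<tau> ! l}"

context
  fixes n D :: nat and \<tau> :: "nat list"
  assumes \<tau>: "\<tau> \<in> segmentations_of_size n D"
begin

lemma num_segments_eq: "num_segments \<tau> = D"
  using \<tau> by (simp add: segmentations_of_size_def num_segments_def)

lemma segment_nonempty: "l \<in> {1..D} \<Longrightarrow> segment \<tau> l \<noteq> {}"
  using segmentation_strict_mono[OF \<tau>, of "l - 1" l] by (auto simp: segment_def)

lemma disjoint_segments: "disjoint_family_on (segment \<tau>) {1..D}"
proof -
  have "segment \<tau> l \<inter> segment \<tau> l' = {}" if "l < l'" "l' \<in> {1..D}" for l l'
  proof -
    have "\<tau> ! l \<le> \<tau> ! (l' - 1)"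
    proof (cases "l = l' - 1")
      case False
      with that show ?thesis
        by (intro less_imp_le segmentation_strict_mono[OF \<tau>]) auto
    qed simp
    then show ?thesis by (auto simp: segment_def)
  qed
  then show ?thesis
    unfolding disjoint_family_on_def by (metis Int_commute linorder_neqE_nat)
qed

lemma Union_segments: "(\<Union>l\<in>{1..D}. segment \<tau> l) = {1..n}"
proof
  have "\<tau> ! l \<le> n" if "l \<in> {1..D}" for l
    using that segmentation_strict_mono[OF \<tau>, of l D] \<tau>
    by (cases "l = D") (auto simp: segmentations_of_size_def)
  then show "(\<Union>l\<in>{1..D}. segment \<tau> l) \<subseteq> {1..n}"
    by (force simp: segment_def)
  show "{1..n} \<subseteq> (\<Union>l\<in>{1..D}. segment \<tau> l)"
  proof
    fix i assume i: "i \<in> {1..n}"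
    define l where "l = (LEAST l. i \<le> \<tau> ! l)"
    have D: "i \<le> \<tau> ! D" using i \<tau> by (simp add: segmentations_of_size_def)
    have 1: "i \<le> \<tau> ! l" unfolding l_def by (rule LeastI[of _ D]) (rule D)
    have 2: "l \<le> D" unfolding l_def by (rule Least_le) (rule D)
    have 3: "l \<noteq> 0"
    proof
      assume "l = 0"
      then show False using 1 i \<tau> by (simp add: segmentations_of_size_def)
    qed
    have "\<not> i \<le> \<tau> ! (l - 1)"
      using 3 unfolding l_def by (intro not_less_Least) simp
    then have "i \<in> segment \<tau> l" using 1 by (simp add: segment_def)
    then show "i \<in> (\<Union>l\<in>{1..D}. segment \<tau> l)" using 2 3 by (intro UN_I[of l]) auto
  qed
qed

lemma segment_subset: "l \<in> {1..D} \<Longrightarrow> segment \<tau> l \<subseteq> {1..n}"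
  using Union_segments by blast

lemma sum_over_segments:
  fixes g :: "nat \<Rightarrow> 'b :: comm_monoid_add"
  shows "(\<Sum>i=1..n. g i) = (\<Sum>l=1..D. \<Sum>i\<in>segment \<tau> l. g i)"
  unfolding Union_segments[symmetric]
  using disjoint_segments by (intro sum.UNION_disjoint) (auto simp: segment_def disjoint_family_on_def)

lemma mem_segment_space_iff:
  "f \<in> segment_space n \<tau> \<longleftrightarrow> f \<in> {1..n} \<rightarrow>\<^sub>E UNIV \<and>
    (\<forall>l\<in>{1..D}. \<forall>i\<in>segment \<tau> l. \<forall>j\<in>segment \<tau> l. f i = f j)"
  by (simp add: segment_space_def segment_def num_segments_eq)

lemma orth_proj_segment_space:
  fixes f :: "nat \<Rightarrow> 'h :: real_inner"
  assumes l: "l \<in> {1..D}" and i: "i \<in> segment \<tau> l"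
  shows "orth_proj n (segment_space n \<tau>) f i
    = (\<Sum>j\<in>segment \<tau> l. f j) /\<^sub>R card (segment \<tau> l)"
proof -
  let ?F = "segment_space n \<tau> :: (nat \<Rightarrow> 'h) set"
  define avg where "avg = (\<lambda>l. (\<Sum>j\<in>segment \<tau> l. f j) /\<^sub>R card (segment \<tau> l))"
  define p where "p = (\<lambda>i\<in>{1..n}. avg (THE l. l \<in> {1..D} \<and> i \<in> segment \<tau> l))"
  have p: "p i = avg l" if "l \<in> {1..D}" "i \<in> segment \<tau> l" for l i
  proof -
    have "(THE l. l \<in> {1..D} \<and> i \<in> segment \<tau> l) = l"
    proof (rule the_equality)
      fix l' assume "l' \<in> {1..D} \<and> i \<in> segment \<tau> l'"
      then show "l' = l" using that disjoint_segments unfolding disjoint_family_on_def by blast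
    qed (use that in simp)
    then show ?thesis using segment_subset[OF that(1)] that(2) by (auto simp: p_def)
  qed
  have pF: "p \<in> ?F"
  proof -
    have "p \<in> {1..n} \<rightarrow>\<^sub>E UNIV" unfolding p_def by simp
    moreover have "p i = p j" if "l \<in> {1..D}" "i \<in> segment \<tau> l" "j \<in> segment \<tau> l" for l i j
      using p[OF that(1,2)] p[OF that(1,3)] by simp
    ultimately show ?thesis unfolding mem_segment_space_iff by blast
  qed
  have orth: "tuple_inner n (\<lambda>i. f i - p i) g = 0" if g: "g \<in> ?F" for g
    unfolding tuple_inner_def sum_over_segments
  proof (rule sum.neutral, rule ballI)
    fix l assume l: "l \<in> {1..D}"
    obtain i0 where i0: "i0 \<in> segment \<tau> l" using segment_nonempty[OF l] by blast
    have "(\<Sum>i\<in>segment \<tau> l. (f i - p i) \<bullet> g i) = (\<Sum>i\<in>segment \<tau> l. (f i - avg l) \<bullet> g i0)"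
    proof (rule sum.cong[OF refl])
      fix i assume i: "i \<in> segment \<tau> l"
      have "g i = g i0" using g l i i0 unfolding mem_segment_space_iff by blast
      then show "(f i - p i) \<bullet> g i = (f i - avg l) \<bullet> g i0" by (simp add: p[OF l i])
    qed
    also have "\<dots> = ((\<Sum>i\<in>segment \<tau> l. f i) - real (card (segment \<tau> l)) *\<^sub>R avg l) \<bullet> g i0"
      by (simp add: sum_subtractf sum_constant_scaleR flip: inner_sum_left)
    also have "\<dots> = 0"
      using i0 by (auto simp: avg_def segment_def)
    finally show "(\<Sum>i\<in>segment \<tau> l. (f i - p i) \<bullet> g i) = 0" .
  qed
  have "orth_proj n ?F f = p"
    unfolding orth_proj_def
  proof (rule the_equality)
    show "p \<in> ?F \<and> (\<forall>g\<in>?F. tuple_inner n (\<lambda>i. f i - p i) g = 0)"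
      using pF orth by blast
  next
    fix q assume q: "q \<in> ?F \<and> (\<forall>g\<in>?F. tuple_inner n (\<lambda>i. f i - q i) g = 0)"
    define g where "g = (\<lambda>i\<in>{1..n}. q i - p i)"
    have "g \<in> ?F"
      unfolding mem_segment_space_iff
    proof (intro conjI ballI)
      fix l i j assume "l \<in> {1..D}" "i \<in> segment \<tau> l" "j \<in> segment \<tau> l"
      moreover from this have "i \<in> {1..n}" "j \<in> {1..n}" using segment_subset by blast+
      moreover have "q i = q j" "p i = p j"
        using q pF \<open>l \<in> {1..D}\<close> \<open>i \<in> segment \<tau> l\<close> \<open>j \<in> segment \<tau> l\<close>
        unfolding mem_segment_space_iff by blast+
      ultimately show "g i = g j" by (simp add: g_def)
    qed (auto simp: g_def)
    then have "tuple_inner n (\<lambda>i. f i - p i) g - tuple_inner n (\<lambda>i. f i - q i) g = 0"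
      using q orth by simp
    also have "tuple_inner n (\<lambda>i. f i - p i) g - tuple_inner n (\<lambda>i. f i - q i) g
        = (\<Sum>i=1..n. (q i - p i) \<bullet> (q i - p i))"
      unfolding tuple_inner_def sum_subtractf[symmetric]
      by (intro sum.cong) (auto simp: g_def inner_diff_left)
    finally have "\<forall>i\<in>{1..n}. (q i - p i) \<bullet> (q i - p i) = 0"
      by (subst (asm) sum_nonneg_eq_0_iff) auto
    then show "q = p"
      using q pF unfolding mem_segment_space_iff by (intro extensionalityI[of _ "{1..n}"]) (auto simp: PiE_def)
  qed
  then show ?thesis using p[OF l i] by (simp add: avg_def)
qed

lemma norm_orth_proj_segment_space:
  fixes f :: "nat \<Rightarrow> 'h :: real_inner"
  shows "(tuple_norm n (orth_proj n (segment_space n \<tau>) f))\<^sup>2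
    = (\<Sum>l=1..D. (norm (\<Sum>i\<in>segment \<tau> l. f i))\<^sup>2 / card (segment \<tau> l))"
proof -
  let ?p = "orth_proj n (segment_space n \<tau>) f"
  have "(tuple_norm n ?p)\<^sup>2 = (\<Sum>i=1..n. (norm (?p i))\<^sup>2)"
    by (simp add: tuple_norm_def tuple_inner_def power2_norm_eq_inner sum_nonneg)
  also have "\<dots> = (\<Sum>l=1..D. \<Sum>i\<in>segment \<tau> l. (norm (?p i))\<^sup>2)"
    by (rule sum_over_segments)
  also have "\<dots> = (\<Sum>l=1..D. (norm (\<Sum>i\<in>segment \<tau> l. f i))\<^sup>2 / card (segment \<tau> l))"
  proof (rule sum.cong[OF refl])
    fix l assume l: "l \<in> {1..D}"
    have "card (segment \<tau> l) \<noteq> 0"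
      using segment_nonempty[OF l] by (simp add: segment_def)
    then show "(\<Sum>i\<in>segment \<tau> l. (norm (?p i))\<^sup>2) = (norm (\<Sum>i\<in>segment \<tau> l. f i))\<^sup>2 / card (segment \<tau> l)"
      by (simp add: orth_proj_segment_space[OF l] power2_eq_square field_simps)
  qed
  finally show ?thesis .
qed

end

section \<open>The feature map of a reproducing kernel Hilbert space\<close>

context
  fixes N :: "'x measure" and k :: "'x \<Rightarrow> 'x \<Rightarrow> real"
    and fct :: "'h :: {real_inner, banach, second_countable_topology} \<Rightarrow> 'x \<Rightarrow> real"
  assumes rkhs: "is_rkhs (space N) k fct"
begin

lemma inner_feature_map:
  assumes "x \<in> space N" "y \<in> space N"
  shows "feature_map (space N) k fct x \<bullet> feature_map (space N) k fct y = k x y"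
proof -
  have *: "(\<forall>z\<in>space N. fct (feature_map (space N) k fct x) z = k x z) \<and>
      (\<forall>f. f \<bullet> feature_map (space N) k fct x = fct f x)" if x: "x \<in> space N" for x
  proof -
    obtain h where h: "\<forall>z\<in>space N. fct h z = k x z" "\<forall>f. f \<bullet> h = fct f x"
      using rkhs x unfolding is_rkhs_def by blast
    have "feature_map (space N) k fct x = h"
      unfolding feature_map_def
    proof (rule the_equality)
      fix h' assume "\<forall>z\<in>space N. fct h' z = k x z"
      then show "h' = h" using rkhs h(1) unfolding is_rkhs_def by auto
    qed (rule h(1))
    then show ?thesis using h by simp
  qed
  show ?thesis using *[OF assms(1)] *[OF assms(2)] assms(2) by auto
qed

lemma norm_feature_map: "x \<in> space N \<Longrightarrow> (norm (feature_map (space N) k fct x))\<^sup>2 = k x x"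
  by (simp add: power2_norm_eq_inner inner_feature_map)

text \<open>
  By the reproducing property, the distance of \<open>\<Phi> x\<close> to a fixed \<open>\<Phi> y\<close> is a measurable function of
  \<open>x\<close>. This suffices: as the Hilbert space is separable, every open set has the same points of the
  range of \<open>\<Phi>\<close> as a countable union of balls centred in that range.
\<close>

lemma measurable_feature_map:
  assumes k: "psd_kernel N k"
  shows "feature_map (space N) k fct \<in> borel_measurable N"
proof (rule borel_measurableI)
  fix U :: "'h set" assume U: "open U"
  let ?\<Phi> = "feature_map (space N) k fct"
  have k_meas: "(\<lambda>p. k (fst p) (snd p)) \<in> borel_measurable (N \<Otimes>\<^sub>M N)"
    using k by (simp add: psd_kernel_def case_prod_beta')
  have k_meas2[measurable]: "(\<lambda>x. k (f x) (g x)) \<in> borel_measurable N"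
    if "f \<in> N \<rightarrow>\<^sub>M N" "g \<in> N \<rightarrow>\<^sub>M N" for f g
    using measurable_compose[OF measurable_Pair[OF that] k_meas] by simp
  have ball: "?\<Phi> -` ball (?\<Phi> y) r \<inter> space N \<in> sets N" if y: "y \<in> space N" for y r
  proof -
    have "dist (?\<Phi> y) (?\<Phi> x) = sqrt (k y y - k y x - (k x y - k x x))" if "x \<in> space N" for x
      using that y by (simp add: dist_norm norm_eq_sqrt_inner inner_diff inner_feature_map)
    then have "?\<Phi> -` ball (?\<Phi> y) r \<inter> space N = {x \<in> space N. sqrt (k y y - k y x - (k x y - k x x)) < r}"
      by auto
    also have "\<dots> \<in> sets N" using y by measurable
    finally show ?thesis .
  qed
  define \<B> where "\<B> = {ball (?\<Phi> y) r | y r. y \<in> space N \<and> ball (?\<Phi> y) r \<subseteq> U}"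
  obtain \<B>' where \<B>': "\<B>' \<subseteq> \<B>" "countable \<B>'" "\<Union>\<B>' = \<Union>\<B>"
    by (rule Lindelof[of \<B>]) (auto simp: \<B>_def)
  have "?\<Phi> x \<in> \<Union>\<B>" if x: "x \<in> space N" "?\<Phi> x \<in> U" for x
  proof -
    obtain r where "0 < r" "ball (?\<Phi> x) r \<subseteq> U" using U x(2) by (auto simp: open_contains_ball)
    then have "ball (?\<Phi> x) r \<in> \<B>" "?\<Phi> x \<in> ball (?\<Phi> x) r" using x(1) by (auto simp: \<B>_def)
    then show ?thesis by blast
  qed
  moreover have "\<Union>\<B> \<subseteq> U" by (auto simp: \<B>_def)
  ultimately have "?\<Phi> -` U \<inter> space N = ?\<Phi> -` (\<Union>\<B>) \<inter> space N" by blast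
  also have "\<dots> = (\<Union>S\<in>\<B>'. ?\<Phi> -` S \<inter> space N)"
    unfolding \<B>'(3)[symmetric] by blast
  also have "\<dots> \<in> sets N"
    using \<B>'(1) ball by (intro sets.countable_UN' \<B>'(2)) (auto simp: \<B>_def)
  finally show "?\<Phi> -` U \<inter> space N \<in> sets N" .
qed

end

section \<open>Concentration of the projected noise\<close>

theorem proposition1:
  fixes P :: "'w measure" and N :: "'x measure"
    and k :: "'x \<Rightarrow> 'x \<Rightarrow> real"
    and fct :: "'h :: {real_inner, banach, second_countable_topology} \<Rightarrow> 'x \<Rightarrow> real"
    and X :: "nat \<Rightarrow> 'w \<Rightarrow> 'x"
    and n :: nat and M x :: real and \<tau> :: "nat list"
  assumes "prob_space P"
    and "n \<ge> 1"
    and "prob_space.indep_vars P (\<lambda>_. N) X {1..n}"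
    and "psd_kernel N k"
    and "is_rkhs (space N) k fct"
    and "M > 0"
    and "\<And>i. i \<in> {1..n} \<Longrightarrow> AE \<omega> in P. k (X i \<omega>) (X i \<omega>) \<le> M\<^sup>2"
    and "\<tau> \<in> segmentations n"
    and "x > 0"
  shows "measure P {\<omega> \<in> space P.
           (tuple_norm n (orth_proj n (segment_space n \<tau>) (noise P N k fct n X \<omega>)))\<^sup>2
           - (\<integral>\<omega>'. (tuple_norm n (orth_proj n (segment_space n \<tau>) (noise P N k fct n X \<omega>')))\<^sup>2 \<partial>P)
           \<le> 14 * M\<^sup>2 / 3 * (x + 2 * sqrt (2 * x * real (num_segments \<tau>)))}
         \<ge> 1 - exp (- x)"
proof -
  interpret prob_space P by fact
  obtain D where D: "D \<in> {1..n}" and \<tau>: "\<tau> \<in> segmentations_of_size n D"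
    using assms(8) by (auto simp: segmentations_def)
  define V where "V = (\<lambda>i \<omega>. feature_map (space N) k fct (X i \<omega>))"
  define W where "W = (\<lambda>l \<omega>.
    (norm (\<Sum>i\<in>segment \<tau> l. V i \<omega> - expectation (V i)))\<^sup>2 / card (segment \<tau> l))"
  have X: "X i \<in> P \<rightarrow>\<^sub>M N" if "i \<in> {1..n}" for i
    using assms(3) that by (auto simp: indep_vars_def)
  have indep: "indep_vars (\<lambda>_. borel) V {1..n}"
    unfolding V_def
    by (rule indep_vars_compose2[OF assms(3) measurable_feature_map[OF assms(5,4)]])
  have bd: "AE \<omega> in P. norm (V i \<omega>) \<le> M" if i: "i \<in> {1..n}" for i
    using assms(7)[OF i] AE_space
  proof eventually_elim
    case (elim \<omega>)
    then have "(norm (V i \<omega>))\<^sup>2 \<le> M\<^sup>2"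
      using measurable_space[OF X[OF i]] by (simp add: V_def norm_feature_map[OF assms(5)])
    then show ?case by (rule power2_le_imp_le) (use \<open>M > 0\<close> in simp)
  qed
  have indep_W: "indep_vars (\<lambda>_. borel) W {1..D}"
  proof -
    define g where "g = (\<lambda>l v.
      (norm (\<Sum>i\<in>segment \<tau> l. v i - expectation (V i)))\<^sup>2 / card (segment \<tau> l))"
    have g: "g l \<in> borel_measurable (PiM (segment \<tau> l) (\<lambda>_. borel))" for l
      unfolding g_def by measurable
    have "indep_vars (\<lambda>_. borel) (\<lambda>l \<omega>. g l (\<lambda>i\<in>segment \<tau> l. V i \<omega>)) {1..D}"
      by (rule indep_vars_compose2[OF
            indep_vars_restrict[OF indep segment_subset[OF \<tau>] disjoint_segments[OF \<tau>]]])
        (auto intro: g)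
    then show ?thesis by (simp add: g_def W_def[abs_def])
  qed
  have int_W: "integrable P (W l)"
    and mgf: "\<And>u. 0 \<le> u \<Longrightarrow> u \<le> 1 \<Longrightarrow>
      (\<integral>\<^sup>+\<omega>. exp (u * ((W l \<omega> - expectation (W l)) / (14 * M\<^sup>2 / 3))) \<partial>P) \<le> ennreal (exp (2 * u\<^sup>2))"
    if l: "l \<in> {1..D}" for l
  proof -
    have "finite (segment \<tau> l)" by (simp add: segment_def)
    note * = this segment_nonempty[OF \<tau> l] indep_vars_subset[OF indep segment_subset[OF \<tau> l]]
      bd[OF subsetD[OF segment_subset[OF \<tau> l]]] \<open>M > 0\<close>
    show "integrable P (W l)"
      unfolding W_def using * by (rule integrable_norm_sum_centered)
    show "(\<integral>\<^sup>+\<omega>. exp (u * ((W l \<omega> - expectation (W l)) / (14 * M\<^sup>2 / 3))) \<partial>P)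
        \<le> ennreal (exp (2 * u\<^sup>2))" if "0 \<le> u" "u \<le> 1" for u
      unfolding W_def using * that by (rule nn_integral_exp_centered_norm_sum)
  qed
  have proj: "(tuple_norm n (orth_proj n (segment_space n \<tau>) (noise P N k fct n X \<omega>)))\<^sup>2
      = (\<Sum>l=1..D. W l \<omega>)" for \<omega>
    unfolding norm_orth_proj_segment_space[OF \<tau>] W_def
  proof (rule sum.cong[OF refl])
    fix l assume l: "l \<in> {1..D}"
    have "(\<Sum>i\<in>segment \<tau> l. noise P N k fct n X \<omega> i)
        = (\<Sum>i\<in>segment \<tau> l. V i \<omega> - expectation (V i))"
      using subsetD[OF segment_subset[OF \<tau> l]] by (intro sum.cong) (auto simp: noise_def V_def)
    then show "(norm (\<Sum>i\<in>segment \<tau> l. noise P N k fct n X \<omega> i))\<^sup>2 / card (segment \<tau> l)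
        = (norm (\<Sum>i\<in>segment \<tau> l. V i \<omega> - expectation (V i)))\<^sup>2 / card (segment \<tau> l)"
      by simp
  qed
  have "1 - exp (- x) \<le> prob {\<omega> \<in> space P. (\<Sum>l=1..D. W l \<omega>) - (\<Sum>l=1..D. expectation (W l))
      \<le> 14 * M\<^sup>2 / 3 * (x + 2 * sqrt (2 * x * card {1..D}))}"
    using D \<open>M > 0\<close> \<open>x > 0\<close>
    by (intro prob_sum_le_of_exp_moments indep_W mgf) auto
  also have "(\<Sum>l=1..D. expectation (W l)) = expectation (\<lambda>\<omega>. \<Sum>l=1..D. W l \<omega>)"
    by (rule Bochner_Integration.integral_sum[symmetric]) (rule int_W)
  finally show ?thesis
    unfolding proj num_segments_eq[OF \<tau>] by simp
qed

end
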